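(* Let $s=(12)$ and $t=(23)$ in the symmetric group $S_3$. The multiset $A=\{s,s,t,t,t,t\}$ (two copies of $s$ and four copies of $t$) is not quotient-realizable in $S_3$.
   Context: All multisets are counted with multiplicity. A multiset $A$ of cardinality $|G|$ with elements in a finite group $G$ (written multiplicatively) is quotient-realizable in $G$ if there exist bijections $b,c:\{1,\ldots,|G|\}\to G$ such that $A=\{b(i)c(i)^{-1}:1\le i\le |G|\}$ as multisets. Permutations in $S_3$ are composed from right to left. *)

theory Defs
  imports "HOL-Algebra.Sym_Groups" "HOL-Library.Multiset"
begin

(* Intended for finite groups G.  That A has cardinality |G| and elements in G then follows from
   the equation, so these requirements are not separate conjuncts. *)
definition quotient_realizable :: "('a, 'b) monoid_scheme \<Rightarrow> 'a multiset \<Rightarrow> bool" where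
  "quotient_realizable G A \<longleftrightarrow>
     (\<exists>b c. bij_betw b {1..order G} (carrier G) \<and> bij_betw c {1..order G} (carrier G) \<and>
        A = {#b i \<otimes>\<^bsub>G\<^esub> inv\<^bsub>G\<^esub> (c i). i \<in># mset_set {1..order G}#})"

end

theory Submission
  imports Defs
begin

text \<open>
  Let \<open>S\<close> be the set of those \<open>c i\<close> whose quotient \<open>b i (c i)\<inverse>\<close> is \<open>s\<close>. Then \<open>b\<close> maps the
  corresponding indices onto \<open>s S\<close> and the remaining ones onto \<open>t (G - S) = G - t S\<close>. As \<open>b\<close> is a
  bijection, \<open>s S = t S\<close>, so \<open>S\<close> is invariant under left multiplication by the 3-cycle \<open>t\<inverse> s\<close>,
  which is impossible for a set of two elements.
\<close>

lemma (in group) l_coset_eq_of_two_quotients: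
  assumes b: "bij_betw b I (carrier G)" and c: "bij_betw c I (carrier G)"
    and st: "s \<in> carrier G" "t \<in> carrier G"
    and q: "\<And>i. i \<in> I \<Longrightarrow> b i \<otimes> inv (c i) \<in> {s, t}"
  defines "J \<equiv> {i \<in> I. b i \<otimes> inv (c i) = s}"
  shows "s <# (c ` J) = t <# (c ` J)"
proof -
  have mem: "b i \<in> carrier G" "c i \<in> carrier G" if "i \<in> I" for i
    using b c that by (auto dest: bij_betwE)
  have solve: "b i = x \<otimes> c i" if "i \<in> I" "b i \<otimes> inv (c i) = x" for i x
    using mem[OF that(1)] that(2) by (auto simp: m_assoc)
  have bJ: "b ` J = s <# (c ` J)"
    using solve by (force simp: J_def l_coset_def)
  \<comment> \<open>Off \<open>J\<close> the quotient is \<open>t\<close>, so there \<open>b\<close>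
    is \<open>c\<close> followed by left translation by \<open>t\<close>.\<close>
  have "b ` (I - J) = (\<lambda>x. t \<otimes> x) ` c ` (I - J)"
    unfolding image_image
  proof (rule image_cong[OF refl])
    fix i assume "i \<in> I - J"
    then show "b i = t \<otimes> c i"
      using solve[of i t] q[of i] by (auto simp: J_def)
  qed
  also have "c ` (I - J) = carrier G - c ` J"
    using c by (subst inj_on_image_set_diff[of c I]) (auto simp: J_def bij_betw_def)
  \<comment> \<open>Left translation by \<open>t\<close> permutes the carrier, hence commutes with
    complements.\<close>
  also have "(\<lambda>x. t \<otimes> x) ` (carrier G - c ` J) = carrier G - (\<lambda>x. t \<otimes> x) ` c ` J"
    using st mem surj_const_mult[of t]
    by (subst inj_on_image_set_diff[OF inj_on_cmult[of t]]) (auto simp: J_def)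
  also have "\<dots> = carrier G - (t <# (c ` J))"
    by (auto simp: l_coset_def)
  finally have "b ` (I - J) = carrier G - (t <# (c ` J))" .
  moreover have "b ` (I - J) = carrier G - b ` J"
    using b by (subst inj_on_image_set_diff[of b I]) (auto simp: J_def bij_betw_def)
  \<comment> \<open>Both cosets lie in the carrier, so they agree once their complements do.\<close>
  moreover have "s <# (c ` J) \<subseteq> carrier G" "t <# (c ` J) \<subseteq> carrier G"
    using st mem by (auto simp: l_coset_def J_def)
  ultimately show ?thesis
    using bJ by auto
qed

theorem proposition5p2:
  fixes s t :: "nat \<Rightarrow> nat"
  defines "s \<equiv> transpose 1 2" and "t \<equiv> transpose 2 3"
  shows "\<not> quotient_realizable (sym_group 3) {#s, s, t, t, t, t#}"
proof
  let ?G = "sym_group 3"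
  let ?I = "{1..order ?G}"
  interpret group ?G by (rule sym_group_is_group)
  assume "quotient_realizable ?G {#s, s, t, t, t, t#}"
  then obtain b c where b: "bij_betw b ?I (carrier ?G)" and c: "bij_betw c ?I (carrier ?G)"
    and A: "{#s, s, t, t, t, t#} = {#b i \<otimes>\<^bsub>?G\<^esub> inv\<^bsub>?G\<^esub> (c i). i \<in># mset_set ?I#}"
    unfolding quotient_realizable_def by blast
  define J where "J = {i \<in> ?I. b i \<otimes>\<^bsub>?G\<^esub> inv\<^bsub>?G\<^esub> (c i) = s}"
  define S where "S = c ` J"
  have "s 1 \<noteq> t 1"
    by (simp add: s_def t_def)
  then have "s \<noteq> t" by metis
  have st: "s \<in> carrier ?G" "t \<in> carrier ?G"
    unfolding s_def t_def sym_group_carrier by (auto intro!: permutes_swap_id)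
  have q: "b i \<otimes>\<^bsub>?G\<^esub> inv\<^bsub>?G\<^esub> (c i) \<in> {s, t}" if "i \<in> ?I" for i
    using arg_cong[OF A, of set_mset] that by auto
  \<comment> \<open>The multiplicity of \<open>s\<close> among the quotients is the size of its
    fibre \<open>J\<close>.\<close>
  have "2 = count {#s, s, t, t, t, t#} s"
    using \<open>s \<noteq> t\<close> by simp
  also have "\<dots> = card J"
    unfolding A J_def count_image_mset
    by (simp add: vimage_def Int_def conj_commute)
  finally have "card J = 2" ..
  moreover have "inj_on c J"
    using c by (auto simp: J_def bij_betw_def intro: inj_on_subset)
  ultimately have S2: "card S = 2"
    by (simp add: S_def card_image)
  have coset: "s <#\<^bsub>?G\<^esub> S = t <#\<^bsub>?G\<^esub> S"
    unfolding S_def J_def by (rule l_coset_eq_of_two_quotients[OF b c st q])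
  \<comment> \<open>In the common coset \<open>s \<circ> x\<close> equals \<open>t \<circ> y\<close>
    with \<open>y \<in> S\<close>; as \<open>t\<close> is an involution,
    \<open>t \<circ> s \<circ> x\<close> is this \<open>y\<close>.\<close>
  have step: "t \<circ> s \<circ> x \<in> S" if "x \<in> S" for x
  proof -
    have "s \<circ> x \<in> s <#\<^bsub>?G\<^esub> S"
      using that by (auto simp: l_coset_def sym_group_mult)
    then obtain y where y: "y \<in> S" "s \<circ> x = t \<circ> y"
      unfolding coset by (auto simp: l_coset_def sym_group_mult)
    then have "t \<circ> s \<circ> x = t \<circ> t \<circ> y"
      by (simp add: comp_assoc)
    then show ?thesis
      using y by (simp add: t_def)
  qed
  obtain x where x: "x \<in> S"
    using S2 by fastforce
  then have "x \<in> carrier ?G"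
    using c by (auto simp: S_def J_def dest: bij_betwE)
  then have "surj x"
    by (auto simp: sym_group_carrier permutes_surj)
  \<comment> \<open>Since \<open>t \<circ> s\<close> sends 1 to 3 and 3 to 2, the values at the
    point that \<open>x\<close> sends to 1 tell \<open>x\<close> and its two successive translates
    apart; so \<open>S\<close> has at least three elements.\<close>
  then obtain a where a: "x a = 1"
    by (metis surj_def)
  let ?y = "t \<circ> s \<circ> x"
  let ?z = "t \<circ> s \<circ> ?y"
  have "?y a = 3" "?z a = 2"
    using a by (simp_all add: s_def t_def transpose_def)
  with a have "distinct (map (\<lambda>f. f a) [x, ?y, ?z])"
    by simp
  then have "distinct [x, ?y, ?z]"
    unfolding distinct_map by blast
  then have "card {x, ?y, ?z} = 3"
    using distinct_card[of "[x, ?y, ?z]"] by simp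
  moreover have "{x, ?y, ?z} \<subseteq> S"
    using x step by blast
  moreover have "finite S"
    using S2 by (simp add: card_ge_0_finite)
  ultimately show False
    using S2 card_mono[of S "{x, ?y, ?z}"] by simp
qed

end
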